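(* Let $T:V\to\mathfrak g$ be a relative Rota-Baxter operator on a Lie-Yamaguti algebra $(\mathfrak g,[\cdot,\cdot],[\![\cdot,\cdot,\cdot]\!])$ (over a field of characteristic $0$) with respect to a representation $(V;\rho,\mu)$. For $\mathfrak X\in\wedge^2\mathfrak g$ define $\delta(\mathfrak X):V\to\mathfrak g$ by $$\delta(\mathfrak X)v=T\big(D_{\rho,\mu}(\mathfrak X)v\big)-[\![\mathfrak X,Tv]\!],\qquad v\in V.$$ Then, for every $\mathfrak X\in\wedge^2\mathfrak g$, $\delta(\mathfrak X)$ is a $1$-cocycle on the sub-adjacent Lie-Yamaguti algebra $(V,[\cdot,\cdot]_T,[\![\cdot,\cdot,\cdot]\!]_T)$ with coefficients in the representation $(\mathfrak g;\varrho,\varpi)$.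
   Context: Lie-Yamaguti algebra: a vector space $\mathfrak g$ with a bilinear bracket $[\cdot,\cdot]:\wedge^2\mathfrak g\to\mathfrak g$ and a trilinear bracket $[\![\cdot,\cdot,\cdot]\!]:\wedge^2\mathfrak g\otimes\mathfrak g\to\mathfrak g$ such that for all $x,y,z,w,t\in\mathfrak g$: (1) $[[x,y],z]+[[y,z],x]+[[z,x],y]+[\![x,y,z]\!]+[\![y,z,x]\!]+[\![z,x,y]\!]=0$; (2) $[\![[x,y],z,w]\!]+[\![[y,z],x,w]\!]+[\![[z,x],y,w]\!]=0$; (3) $[\![x,y,[z,w]]\!]=[[\![x,y,z]\!],w]+[z,[\![x,y,w]\!]]$; (4) $[\![x,y,[\![z,w,t]\!]]\!]=[\![[\![x,y,z]\!],w,t]\!]+[\![z,[\![x,y,w]\!],t]\!]+[\![z,w,[\![x,y,t]\!]]\!]$. Representation $(V;\rho,\mu)$: a vector space $V$ with linear maps $\rho:\mathfrak g\to\mathfrak{gl}(V)$, $\mu:\otimes^2\mathfrak g\to\mathfrak{gl}(V)$ such that, with $D(x,y)=D_{\rho,\mu}(x,y):=\mu(y,x)-\mu(x,y)+[\rho(x),\rho(y)]-\rho([x,y])$, for all $x,y,z,w\in\mathfrak g$: $\mu([x,y],z)-\mu(x,z)\rho(y)+\mu(y,z)\rho(x)=0$; $\mu(x,[y,z])-\rho(y)\mu(x,z)+\rho(z)\mu(x,y)=0$; $\rho([\![x,y,z]\!])=[D(x,y),\rho(z)]$; $\mu(z,w)\mu(x,y)-\mu(y,w)\mu(x,z)-\mu(x,[\![y,z,w]\!])+D(y,z)\mu(x,w)=0$;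 $\mu([\![x,y,z]\!],w)+\mu(z,[\![x,y,w]\!])=[D(x,y),\mu(z,w)]$. $D_{\rho,\mu}$ is skew-symmetric; for $\mathfrak X=\sum x_i\wedge y_i$ write $D_{\rho,\mu}(\mathfrak X)=\sum D_{\rho,\mu}(x_i,y_i)$ and $[\![\mathfrak X,z]\!]=\sum[\![x_i,y_i,z]\!]$. Relative Rota-Baxter operator on $\mathfrak g$ with respect to $(V;\rho,\mu)$: a linear map $T:V\to\mathfrak g$ with, for all $u,v,w\in V$, $[Tu,Tv]=T(\rho(Tu)v-\rho(Tv)u)$ and $[\![Tu,Tv,Tw]\!]=T(D_{\rho,\mu}(Tu,Tv)w+\mu(Tv,Tw)u-\mu(Tu,Tw)v)$. Sub-adjacent Lie-Yamaguti algebra of $T$: $V$ with $[u,v]_T=\rho(Tu)v-\rho(Tv)u$, $[\![u,v,w]\!]_T=D_{\rho,\mu}(Tu,Tv)w+\mu(Tv,Tw)u-\mu(Tu,Tw)v$. It has the representation $(\mathfrak g;\varrho,\varpi)$ given by $\varrho(u)x=[Tu,x]+T(\rho(x)u)$, $\varpi(u,v)x=[\![x,Tu,Tv]\!]-T(D_{\rho,\mu}(x,Tu)v-\mu(x,Tv)u)$, for which $D_{\varrho,\varpi}(u,v)x=[\![Tu,Tv,x]\!]-T(\mu(Tv,x)u-\mu(Tu,x)v)$. A linear map $f:V\to\mathfrak g$ is a $1$-cocycle on $(V,[\cdot,\cdot]_T,[\![\cdot,\cdot,\cdot]\!]_T)$ with coefficients in $(\mathfrak g;\varrho,\varpi)$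 if for all $u,v,w\in V$: $\varrho(u)f(v)-\varrho(v)f(u)-f([u,v]_T)=0$ and $D_{\varrho,\varpi}(u,v)f(w)+\varpi(v,w)f(u)-\varpi(u,w)f(v)-f([\![u,v,w]\!]_T)=0$. *)

theory Defs
  imports Complex_Main "HOL-Library.Poly_Mapping"
begin

section \<open>Multilinear maps\<close>

definition bilinear_map ::
  "('k::field \<Rightarrow> 'a::ab_group_add \<Rightarrow> 'a) \<Rightarrow> ('k \<Rightarrow> 'b::ab_group_add \<Rightarrow> 'b) \<Rightarrow>
   ('k \<Rightarrow> 'c::ab_group_add \<Rightarrow> 'c) \<Rightarrow> ('a \<Rightarrow> 'b \<Rightarrow> 'c) \<Rightarrow> bool" where
  "bilinear_map sA sB sC B \<longleftrightarrow>
     (\<forall>x. Vector_Spaces.linear sB sC (B x)) \<and> (\<forall>y. Vector_Spaces.linear sA sC (\<lambda>x. B x y))"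

text \<open>Alternating bilinear maps are the linear maps out of the exterior square.\<close>

definition alternating_map ::
  "('k::field \<Rightarrow> 'a::ab_group_add \<Rightarrow> 'a) \<Rightarrow> ('k \<Rightarrow> 'c::ab_group_add \<Rightarrow> 'c) \<Rightarrow>
   ('a \<Rightarrow> 'a \<Rightarrow> 'c) \<Rightarrow> bool" where
  "alternating_map sA sC B \<longleftrightarrow> bilinear_map sA sA sC B \<and> (\<forall>x. B x x = 0)"

section \<open>The exterior square\<close>

text \<open>
  The exterior square of a vector space is the free vector space on the set of pairs modulo the
  subspace generated by the bilinearity relations and the pairs \<open>(x, x)\<close>. Its elements are
  the equivalence classes of formal linear combinations of pairs.
\<close>

definition free_scale :: "'k::field \<Rightarrow> ('b \<Rightarrow>\<^sub>0 'k) \<Rightarrow> ('b \<Rightarrow>\<^sub>0 'k)" where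
  "free_scale c p = Poly_Mapping.map (\<lambda>a. c * a) p"

definition ext2_relators :: "('k::field \<Rightarrow> 'a::ab_group_add \<Rightarrow> 'a) \<Rightarrow> (('a \<times> 'a) \<Rightarrow>\<^sub>0 'k) set" where
  "ext2_relators sA =
     {Poly_Mapping.single (x + x', y) 1 - Poly_Mapping.single (x, y) 1
        - Poly_Mapping.single (x', y) 1 | x x' y. True} \<union>
     {Poly_Mapping.single (x, y + y') 1 - Poly_Mapping.single (x, y) 1
        - Poly_Mapping.single (x, y') 1 | x y y'. True} \<union>
     {Poly_Mapping.single (sA c x, y) 1 - Poly_Mapping.single (x, y) c | c x y. True} \<union>
     {Poly_Mapping.single (x, sA c y) 1 - Poly_Mapping.single (x, y) c | c x y. True} \<union>
     {Poly_Mapping.single (x, x) 1 | x. True}"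

definition ext2_rel ::
  "('k::field \<Rightarrow> 'a::ab_group_add \<Rightarrow> 'a) \<Rightarrow> ((('a \<times> 'a) \<Rightarrow>\<^sub>0 'k) \<times> (('a \<times> 'a) \<Rightarrow>\<^sub>0 'k)) set" where
  "ext2_rel sA = {(p, q). p - q \<in> module.span free_scale (ext2_relators sA)}"

definition ext2 :: "('k::field \<Rightarrow> 'a::ab_group_add \<Rightarrow> 'a) \<Rightarrow> (('a \<times> 'a) \<Rightarrow>\<^sub>0 'k) set set" where
  "ext2 sA = UNIV // ext2_rel sA"

text \<open>\<open>wedge_sum sA [(x\<^sub>1, y\<^sub>1), \<dots>]\<close> is the sum of the \<open>x\<^sub>i \<and> y\<^sub>i\<close>.\<close>

definition wedge_sum ::
  "('k::field \<Rightarrow> 'a::ab_group_add \<Rightarrow> 'a) \<Rightarrow> ('a \<times> 'a) list \<Rightarrow> (('a \<times> 'a) \<Rightarrow>\<^sub>0 'k) set" where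
  "wedge_sum sA xs = ext2_rel sA `` {\<Sum>z\<leftarrow>xs. Poly_Mapping.single z 1}"

definition formal_eval ::
  "('k::field \<Rightarrow> 'c::ab_group_add \<Rightarrow> 'c) \<Rightarrow> ('a \<Rightarrow> 'a \<Rightarrow> 'c) \<Rightarrow> (('a \<times> 'a) \<Rightarrow>\<^sub>0 'k) \<Rightarrow> 'c" where
  "formal_eval sC B p = (\<Sum>z\<in>Poly_Mapping.keys p. sC (Poly_Mapping.lookup p z) (B (fst z) (snd z)))"

text \<open>
  The linear map on the exterior square induced by an alternating map \<open>B\<close>: the common value of
  all representatives. It is meaningful only for alternating \<open>B\<close>; see \<open>ext2_lift_class\<close> and
  \<open>ext2_lift_wedge_sum\<close> below.
\<close>

definition ext2_lift ::
  "('k::field \<Rightarrow> 'c::ab_group_add \<Rightarrow> 'c) \<Rightarrow> ('a \<Rightarrow> 'a \<Rightarrow> 'c) \<Rightarrow> (('a \<times> 'a) \<Rightarrow>\<^sub>0 'k) set \<Rightarrow> 'c" where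
  "ext2_lift sC B X = the_elem (formal_eval sC B ` X)"

section \<open>Lie-Yamaguti algebras and representations\<close>

locale lie_yamaguti = vector_space sG
  for sG :: "'k::field \<Rightarrow> 'g::ab_group_add \<Rightarrow> 'g" +
  fixes br :: "'g \<Rightarrow> 'g \<Rightarrow> 'g"
    and tr :: "'g \<Rightarrow> 'g \<Rightarrow> 'g \<Rightarrow> 'g"
  assumes br_alternating: "alternating_map sG sG br"
    and tr_alternating: "\<And>z. alternating_map sG sG (\<lambda>x y. tr x y z)"
    and tr_linear: "\<And>x y. Vector_Spaces.linear sG sG (tr x y)"
    and LY1: "\<And>x y z. br (br x y) z + br (br y z) x + br (br z x) y
                + tr x y z + tr y z x + tr z x y = 0"
    and LY2: "\<And>x y z w. tr (br x y) z w + tr (br y z) x w + tr (br z x) y w = 0"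
    and LY3: "\<And>x y z w. tr x y (br z w) = br (tr x y z) w + br z (tr x y w)"
    and LY4: "\<And>x y z w t. tr x y (tr z w t)
                = tr (tr x y z) w t + tr z (tr x y w) t + tr z w (tr x y t)"

text \<open>Elements of \<open>gl(V)\<close> are applied to vectors throughout, so that composition and commutator
  are written out; \<open>D_op br \<rho> \<mu> x y\<close> is the endomorphism \<open>D(x, y)\<close> of \<open>V\<close>.\<close>

definition D_op ::
  "('g \<Rightarrow> 'g \<Rightarrow> 'g) \<Rightarrow> ('g \<Rightarrow> 'v \<Rightarrow> 'v) \<Rightarrow> ('g \<Rightarrow> 'g \<Rightarrow> 'v \<Rightarrow> 'v) \<Rightarrow> 'g \<Rightarrow> 'g \<Rightarrow> 'v::ab_group_add \<Rightarrow> 'v" where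
  "D_op br \<rho> \<mu> x y v =
     \<mu> y x v - \<mu> x y v + (\<rho> x (\<rho> y v) - \<rho> y (\<rho> x v)) - \<rho> (br x y) v"

locale ly_representation = lie_yamaguti sG br tr + V: vector_space sV
  for sG :: "'k::field \<Rightarrow> 'g::ab_group_add \<Rightarrow> 'g"
    and br tr
    and sV :: "'k \<Rightarrow> 'v::ab_group_add \<Rightarrow> 'v" +
  fixes \<rho> :: "'g \<Rightarrow> 'v \<Rightarrow> 'v"
    and \<mu> :: "'g \<Rightarrow> 'g \<Rightarrow> 'v \<Rightarrow> 'v"
  assumes rho_bilinear: "bilinear_map sG sV sV \<rho>"
    and mu_linear: "\<And>x y. Vector_Spaces.linear sV sV (\<mu> x y)"
    and mu_bilinear: "\<And>v. bilinear_map sG sG sV (\<lambda>x y. \<mu> x y v)"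
    and rep1: "\<And>x y z v. \<mu> (br x y) z v - \<mu> x z (\<rho> y v) + \<mu> y z (\<rho> x v) = 0"
    and rep2: "\<And>x y z v. \<mu> x (br y z) v - \<rho> y (\<mu> x z v) + \<rho> z (\<mu> x y v) = 0"
    and rep3: "\<And>x y z v. \<rho> (tr x y z) v
                 = D_op br \<rho> \<mu> x y (\<rho> z v) - \<rho> z (D_op br \<rho> \<mu> x y v)"
    and rep4: "\<And>x y z w v. \<mu> z w (\<mu> x y v) - \<mu> y w (\<mu> x z v) - \<mu> x (tr y z w) v
                 + D_op br \<rho> \<mu> y z (\<mu> x w v) = 0"
    and rep5: "\<And>x y z w v. \<mu> (tr x y z) w v + \<mu> z (tr x y w) v
                 = D_op br \<rho> \<mu> x y (\<mu> z w v) - \<mu> z w (D_op br \<rho> \<mu> x y v)"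

section \<open>Relative Rota-Baxter operators\<close>

text \<open>
  For a relative Rota-Baxter operator \<open>T\<close>, \<open>sub_br\<close> and \<open>sub_tr\<close> are the operations of the
  sub-adjacent Lie-Yamaguti algebra on \<open>V\<close>, and \<open>sub_rho\<close>, \<open>sub_mu\<close> its representation on \<open>g\<close>.
\<close>

definition sub_br :: "('g \<Rightarrow> 'v \<Rightarrow> 'v) \<Rightarrow> ('v \<Rightarrow> 'g) \<Rightarrow> 'v \<Rightarrow> 'v \<Rightarrow> 'v::ab_group_add" where
  "sub_br \<rho> T u v = \<rho> (T u) v - \<rho> (T v) u"

definition sub_tr ::
  "('g \<Rightarrow> 'g \<Rightarrow> 'g) \<Rightarrow> ('g \<Rightarrow> 'v \<Rightarrow> 'v) \<Rightarrow> ('g \<Rightarrow> 'g \<Rightarrow> 'v \<Rightarrow> 'v) \<Rightarrow> ('v \<Rightarrow> 'g) \<Rightarrow>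
   'v \<Rightarrow> 'v \<Rightarrow> 'v \<Rightarrow> 'v::ab_group_add" where
  "sub_tr br \<rho> \<mu> T u v w =
     D_op br \<rho> \<mu> (T u) (T v) w + \<mu> (T v) (T w) u - \<mu> (T u) (T w) v"

locale relative_rota_baxter = ly_representation sG br tr sV \<rho> \<mu>
  for sG :: "'k::field \<Rightarrow> 'g::ab_group_add \<Rightarrow> 'g"
    and br tr
    and sV :: "'k \<Rightarrow> 'v::ab_group_add \<Rightarrow> 'v"
    and \<rho> \<mu> +
  fixes T :: "'v \<Rightarrow> 'g"
  assumes T_linear: "Vector_Spaces.linear sV sG T"
    and T_br: "\<And>u v. br (T u) (T v) = T (\<rho> (T u) v - \<rho> (T v) u)"
    and T_tr: "\<And>u v w. tr (T u) (T v) (T w)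
                 = T (D_op br \<rho> \<mu> (T u) (T v) w + \<mu> (T v) (T w) u - \<mu> (T u) (T w) v)"

definition sub_rho ::
  "('g \<Rightarrow> 'g \<Rightarrow> 'g) \<Rightarrow> ('g \<Rightarrow> 'v \<Rightarrow> 'v) \<Rightarrow> ('v \<Rightarrow> 'g) \<Rightarrow> 'v \<Rightarrow> 'g \<Rightarrow> 'g::ab_group_add" where
  "sub_rho br \<rho> T u x = br (T u) x + T (\<rho> x u)"

definition sub_mu ::
  "('g \<Rightarrow> 'g \<Rightarrow> 'g) \<Rightarrow> ('g \<Rightarrow> 'g \<Rightarrow> 'g \<Rightarrow> 'g) \<Rightarrow> ('g \<Rightarrow> 'v \<Rightarrow> 'v) \<Rightarrow> ('g \<Rightarrow> 'g \<Rightarrow> 'v \<Rightarrow> 'v) \<Rightarrow>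
   ('v::ab_group_add \<Rightarrow> 'g) \<Rightarrow> 'v \<Rightarrow> 'v \<Rightarrow> 'g \<Rightarrow> 'g::ab_group_add" where
  "sub_mu br tr \<rho> \<mu> T u v x = tr x (T u) (T v) - T (D_op br \<rho> \<mu> x (T u) v - \<mu> x (T v) u)"

text \<open>
  1-cocycles on an algebra with operations \<open>br\<close>, \<open>tr\<close> and coefficients in \<open>(\<rho>, \<mu>)\<close>, for which
  \<open>D\<close> is the operator determined by \<open>br\<close>, \<open>\<rho>\<close> and \<open>\<mu>\<close>.
\<close>

definition one_cocycle ::
  "('k::field \<Rightarrow> 'a::ab_group_add \<Rightarrow> 'a) \<Rightarrow> ('a \<Rightarrow> 'a \<Rightarrow> 'a) \<Rightarrow> ('a \<Rightarrow> 'a \<Rightarrow> 'a \<Rightarrow> 'a) \<Rightarrow>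
   ('k \<Rightarrow> 'w::ab_group_add \<Rightarrow> 'w) \<Rightarrow> ('a \<Rightarrow> 'w \<Rightarrow> 'w) \<Rightarrow> ('a \<Rightarrow> 'a \<Rightarrow> 'w \<Rightarrow> 'w) \<Rightarrow>
   ('a \<Rightarrow> 'w) \<Rightarrow> bool" where
  "one_cocycle sA br tr sW \<rho> \<mu> f \<longleftrightarrow>
     Vector_Spaces.linear sA sW f \<and>
     (\<forall>u v. \<rho> u (f v) - \<rho> v (f u) - f (br u v) = 0) \<and>
     (\<forall>u v w. D_op br \<rho> \<mu> u v (f w) + \<mu> v w (f u) - \<mu> u w (f v) - f (tr u v w) = 0)"

definition D_ext ::
  "('g \<Rightarrow> 'g \<Rightarrow> 'g) \<Rightarrow> ('k::field \<Rightarrow> 'v::ab_group_add \<Rightarrow> 'v) \<Rightarrow> ('g \<Rightarrow> 'v \<Rightarrow> 'v) \<Rightarrow>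
   ('g \<Rightarrow> 'g \<Rightarrow> 'v \<Rightarrow> 'v) \<Rightarrow> (('g \<times> 'g) \<Rightarrow>\<^sub>0 'k) set \<Rightarrow> 'v \<Rightarrow> 'v" where
  "D_ext br sV \<rho> \<mu> X v = ext2_lift sV (\<lambda>x y. D_op br \<rho> \<mu> x y v) X"

definition tr_ext ::
  "('k::field \<Rightarrow> 'g::ab_group_add \<Rightarrow> 'g) \<Rightarrow> ('g \<Rightarrow> 'g \<Rightarrow> 'g \<Rightarrow> 'g) \<Rightarrow>
   (('g \<times> 'g) \<Rightarrow>\<^sub>0 'k) set \<Rightarrow> 'g \<Rightarrow> 'g" where
  "tr_ext sG tr X z = ext2_lift sG (\<lambda>x y. tr x y z) X"

definition rb_delta ::
  "('k::field \<Rightarrow> 'g::ab_group_add \<Rightarrow> 'g) \<Rightarrow> ('g \<Rightarrow> 'g \<Rightarrow> 'g) \<Rightarrow> ('g \<Rightarrow> 'g \<Rightarrow> 'g \<Rightarrow> 'g) \<Rightarrow>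
   ('k \<Rightarrow> 'v::ab_group_add \<Rightarrow> 'v) \<Rightarrow> ('g \<Rightarrow> 'v \<Rightarrow> 'v) \<Rightarrow> ('g \<Rightarrow> 'g \<Rightarrow> 'v \<Rightarrow> 'v) \<Rightarrow> ('v \<Rightarrow> 'g) \<Rightarrow>
   (('g \<times> 'g) \<Rightarrow>\<^sub>0 'k) set \<Rightarrow> 'v \<Rightarrow> 'g" where
  "rb_delta sG br tr sV \<rho> \<mu> T X v = T (D_ext br sV \<rho> \<mu> X v) - tr_ext sG tr X (T v)"

section \<open>Well-definedness of the extension to the exterior square\<close>

lemma lookup_free_scale [simp]:
  "Poly_Mapping.lookup (free_scale c p) z = c * Poly_Mapping.lookup p z"
  unfolding free_scale_def by (simp add: Poly_Mapping.map.rep_eq when_def)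

interpretation free: vector_space "free_scale :: 'k::field \<Rightarrow> ('b \<Rightarrow>\<^sub>0 'k) \<Rightarrow> _"
  by unfold_locales (auto intro!: poly_mapping_eqI simp: lookup_add algebra_simps)

lemma equiv_ext2_rel: "equiv UNIV (ext2_rel sA)"
proof (rule equivI)
  show "refl (ext2_rel sA)"
    by (auto simp: refl_on_def ext2_rel_def free.span_zero)
  show "sym (ext2_rel sA)"
    unfolding sym_def ext2_rel_def using free.span_neg by fastforce
  show "trans (ext2_rel sA)"
    unfolding trans_def ext2_rel_def using free.span_add by fastforce
qed auto

lemma formal_eval_superset:
  assumes "vector_space sC" "finite S" "Poly_Mapping.keys p \<subseteq> S"
  shows "formal_eval sC B p = (\<Sum>z\<in>S. sC (Poly_Mapping.lookup p z) (B (fst z) (snd z)))"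
proof -
  interpret vector_space sC by fact
  show ?thesis unfolding formal_eval_def
    by (rule sum.mono_neutral_left) (use assms in \<open>auto simp: in_keys_iff\<close>)
qed

lemma formal_eval_linear:
  assumes "vector_space sC"
  shows "Vector_Spaces.linear free_scale sC (formal_eval sC B)"
proof -
  interpret vector_space sC by fact
  have add: "formal_eval sC B (p + q) = formal_eval sC B p + formal_eval sC B q" for p q
  proof -
    let ?S = "Poly_Mapping.keys p \<union> Poly_Mapping.keys q"
    have "Poly_Mapping.keys (p + q) \<subseteq> ?S" by (rule Poly_Mapping.keys_add)
    then show ?thesis
      by (simp add: formal_eval_superset[OF assms, of ?S] lookup_add scale_left_distrib sum.distrib)
  qed
  have scale: "formal_eval sC B (free_scale c p) = sC c (formal_eval sC B p)" for c p
  proof -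
    have "Poly_Mapping.keys (free_scale c p) \<subseteq> Poly_Mapping.keys p"
      by (auto simp: in_keys_iff)
    then show ?thesis
      by (simp add: formal_eval_superset[OF assms, of "Poly_Mapping.keys p"] scale_sum_right)
  qed
  show ?thesis
    by unfold_locales (use add scale in auto)
qed

lemma formal_eval_single:
  assumes "vector_space sC"
  shows "formal_eval sC B (Poly_Mapping.single z c) = sC c (B (fst z) (snd z))"
proof -
  interpret vector_space sC by fact
  show ?thesis
    by (subst formal_eval_superset[OF assms, of "{z}"]) auto
qed

lemma formal_eval_relators:
  assumes "alternating_map sA sC B" "p \<in> module.span free_scale (ext2_relators sA)"
  shows "formal_eval sC B p = 0"
proof -
  have lin: "Vector_Spaces.linear sA sC (B x)" "Vector_Spaces.linear sA sC (\<lambda>x. B x y)" for x y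
    using assms(1) by (auto simp: alternating_map_def bilinear_map_def)
  interpret L: Vector_Spaces.linear sA sC "B x" for x by (rule lin)
  interpret R: Vector_Spaces.linear sA sC "\<lambda>x. B x y" for y by (rule lin)
  have vs: "vector_space sC" by (rule L.vs2.vector_space_axioms)
  interpret E: Vector_Spaces.linear free_scale sC "formal_eval sC B"
    by (rule formal_eval_linear[OF vs])
  show ?thesis
    using assms(2)
  proof (induction rule: free.span_induct_alt)
    case base
    show ?case by (rule E.zero)
  next
    case (step c x y)
    have "formal_eval sC B x = 0"
      using step(1) assms(1) unfolding ext2_relators_def
      by (auto simp: E.diff formal_eval_single[OF vs] L.add R.add L.scale R.scale alternating_map_def)
    then show ?case using step by (simp add: E.add E.scale)
  qed
qed

lemma ext2_lift_class:
  assumes "alternating_map sA sC B"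
  shows "ext2_lift sC B (ext2_rel sA `` {p}) = formal_eval sC B p"
proof -
  interpret L: Vector_Spaces.linear sA sC "B x" for x
    using assms by (auto simp: alternating_map_def bilinear_map_def)
  interpret E: Vector_Spaces.linear free_scale sC "formal_eval sC B"
    by (rule formal_eval_linear[OF L.vs2.vector_space_axioms])
  have "formal_eval sC B q = formal_eval sC B p" if "q \<in> ext2_rel sA `` {p}" for q
    using formal_eval_relators[OF assms, of "p - q"] that by (simp add: ext2_rel_def E.diff)
  moreover have "p \<in> ext2_rel sA `` {p}"
    by (simp add: ext2_rel_def free.span_zero)
  ultimately have "formal_eval sC B ` (ext2_rel sA `` {p}) = {formal_eval sC B p}"
    by blast
  then show ?thesis by (simp add: ext2_lift_def)
qed

lemma ext2_lift_wedge_sum: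
  assumes "alternating_map sA sC B"
  shows "ext2_lift sC B (wedge_sum sA xs) = (\<Sum>(x, y)\<leftarrow>xs. B x y)"
proof -
  interpret L: Vector_Spaces.linear sA sC "B x" for x
    using assms by (auto simp: alternating_map_def bilinear_map_def)
  have vs: "vector_space sC" by (rule L.vs2.vector_space_axioms)
  interpret E: Vector_Spaces.linear free_scale sC "formal_eval sC B"
    by (rule formal_eval_linear[OF vs])
  show ?thesis
    unfolding wedge_sum_def ext2_lift_class[OF assms]
    by (induction xs) (auto simp: E.zero E.add formal_eval_single[OF vs])
qed

lemma ext2_eq_wedge_sums:
  "ext2 sA = range (wedge_sum sA)"
proof
  have ex: "\<exists>xs. (p, \<Sum>z\<leftarrow>xs. Poly_Mapping.single z 1) \<in> ext2_rel sA" for p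
  proof (induction p rule: update_induct)
    case const
    show ?case
      by (intro exI[of _ "[]"]) (simp add: ext2_rel_def free.span_zero)
  next
    case (update p k v)
    from update.IH obtain xs where
      xs: "p - (\<Sum>z\<leftarrow>xs. Poly_Mapping.single z 1) \<in> module.span free_scale (ext2_relators sA)"
      by (auto simp: ext2_rel_def)
    obtain x y where k: "k = (x, y)" by force
    have upd: "Poly_Mapping.update k v p = p + Poly_Mapping.single k v"
      using update.hyps
      by (intro poly_mapping_eqI) (auto simp: lookup_update lookup_add lookup_single in_keys_iff)
    have "Poly_Mapping.single (sA v x, y) 1 - Poly_Mapping.single (x, y) v
            \<in> module.span free_scale (ext2_relators sA)"
      by (rule free.span_base) (unfold ext2_relators_def, blast)
    from free.span_diff[OF xs this] show ?case
      by (intro exI[of _ "(sA v x, y) # xs"]) (simp add: ext2_rel_def upd[unfolded k] k algebra_simps)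
  qed
  show "ext2 sA \<subseteq> range (wedge_sum sA)"
    unfolding ext2_def wedge_sum_def
    using ex equiv_class_eq[OF equiv_ext2_rel] by (fastforce elim!: quotientE)
  show "range (wedge_sum sA) \<subseteq> ext2 sA"
    by (auto simp: ext2_def wedge_sum_def quotientI)
qed

context ly_representation
begin

lemma D_op_alternating: "alternating_map sG sV (\<lambda>x y. D_op br \<rho> \<mu> x y v)"
proof -
  interpret R1: Vector_Spaces.linear sV sV "\<rho> x" for x
    using rho_bilinear by (simp add: bilinear_map_def)
  interpret R2: Vector_Spaces.linear sG sV "\<lambda>x. \<rho> x v" for v
    using rho_bilinear by (simp add: bilinear_map_def)
  interpret M1: Vector_Spaces.linear sG sV "\<lambda>y. \<mu> x y v" for x v
    using mu_bilinear by (simp add: bilinear_map_def)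
  interpret M2: Vector_Spaces.linear sG sV "\<lambda>x. \<mu> x y v" for y v
    using mu_bilinear by (simp add: bilinear_map_def)
  interpret B1: Vector_Spaces.linear sG sG "br x" for x
    using br_alternating by (simp add: alternating_map_def bilinear_map_def)
  interpret B2: Vector_Spaces.linear sG sG "\<lambda>x. br x y" for y
    using br_alternating by (simp add: alternating_map_def bilinear_map_def)
  have "br x x = 0" for x
    using br_alternating by (simp add: alternating_map_def)
  then show ?thesis
    unfolding alternating_map_def bilinear_map_def D_op_def
    by (intro conjI allI; (unfold_locales)?)
      (auto simp: R1.add R2.add M1.add M2.add B1.add B2.add R1.scale R2.scale M1.scale M2.scale
        B1.scale B2.scale R2.zero V.scale_right_distrib V.scale_right_diff_distrib algebra_simps)
qed

lemma D_ext_wedge_sum: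
  "D_ext br sV \<rho> \<mu> (wedge_sum sG xs) v = (\<Sum>(x, y)\<leftarrow>xs. D_op br \<rho> \<mu> x y v)"
  unfolding D_ext_def by (rule ext2_lift_wedge_sum[OF D_op_alternating])

lemma tr_ext_wedge_sum:
  "tr_ext sG tr (wedge_sum sG xs) z = (\<Sum>(x, y)\<leftarrow>xs. tr x y z)"
  unfolding tr_ext_def by (rule ext2_lift_wedge_sum[OF tr_alternating])

end

end

theory Submission
  imports Defs
begin

text \<open>
  For \<open>X\<close> in the exterior square, the pair \<open>(t, D)\<close> of \<open>t = tr(X, -)\<close> and \<open>D = D(X)\<close> is an
  infinitesimal automorphism of the algebra together with its representation: \<open>t\<close> is a derivation
  of both brackets, and \<open>[D, \<rho>(z)] = \<rho>(t z)\<close>, \<open>[D, \<mu>(z, w)] = \<mu>(t z, w) + \<mu>(z, t w)\<close>.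
  The cocycle conditions for \<open>T D - t T\<close> are then the linearisation of the Rota-Baxter identities
  of \<open>T\<close> along such a pair.
\<close>

lemma alternating_map_skew:
  fixes B :: "'a::ab_group_add \<Rightarrow> 'a \<Rightarrow> 'c::ab_group_add"
  assumes "alternating_map sA sC B"
  shows "B x y = - B y x"
proof -
  interpret L: Vector_Spaces.linear sA sC "B z" for z
    using assms by (simp add: alternating_map_def bilinear_map_def)
  interpret R: Vector_Spaces.linear sA sC "\<lambda>w. B w z" for z
    using assms by (simp add: alternating_map_def bilinear_map_def)
  have alt: "B z z = 0" for z
    using assms by (simp add: alternating_map_def)
  have "B (x + y) (x + y) = B x x + (B x y + B y x) + B y y"
    by (simp only: L.add R.add ac_simps)
  then have "B x y + B y x = 0"
    by (simp only: alt add_0_left add_0_right)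
  then show ?thesis
    by (simp only: eq_neg_iff_add_eq_0)
qed

context ly_representation
begin

sublocale rho: Vector_Spaces.linear sV sV "\<rho> x" for x
  using rho_bilinear by (simp add: bilinear_map_def)

sublocale rho_arg: Vector_Spaces.linear sG sV "\<lambda>x. \<rho> x v" for v
  using rho_bilinear by (simp add: bilinear_map_def)

sublocale mu: Vector_Spaces.linear sV sV "\<mu> x y" for x y
  by (rule mu_linear)

sublocale mu_left: Vector_Spaces.linear sG sV "\<lambda>x. \<mu> x y v" for y v
  using mu_bilinear by (simp add: bilinear_map_def)

sublocale mu_right: Vector_Spaces.linear sG sV "\<lambda>y. \<mu> x y v" for x v
  using mu_bilinear by (simp add: bilinear_map_def)

sublocale br_left: Vector_Spaces.linear sG sG "\<lambda>x. br x y" for y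
  using br_alternating by (simp add: alternating_map_def bilinear_map_def)

sublocale br_right: Vector_Spaces.linear sG sG "br x" for x
  using br_alternating by (simp add: alternating_map_def bilinear_map_def)

sublocale tr_left: Vector_Spaces.linear sG sG "\<lambda>x. tr x y z" for y z
  using tr_alternating by (simp add: alternating_map_def bilinear_map_def)

sublocale tr_middle: Vector_Spaces.linear sG sG "\<lambda>y. tr x y z" for x z
  using tr_alternating by (simp add: alternating_map_def bilinear_map_def)

sublocale tr_right: Vector_Spaces.linear sG sG "tr x y" for x y
  by (rule tr_linear)

lemmas br_skew = alternating_map_skew[OF br_alternating]

lemmas tr_skew = alternating_map_skew[OF tr_alternating]

lemma D_op_linear: "Vector_Spaces.linear sV sV (D_op br \<rho> \<mu> x y)"
  by unfold_locales
    (auto simp: D_op_def rho.add mu.add rho.scale mu.scale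
      V.scale_right_distrib V.scale_right_diff_distrib algebra_simps)

text \<open>Equivalently, \<open>(x, v) \<mapsto> (t x, D v)\<close> is a derivation of the
  semidirect product of g and V. The conditions are linear in the pair \<open>(t, D)\<close>, so
  they survive sums.\<close>

definition derivation_pair :: "('g \<Rightarrow> 'g) \<Rightarrow> ('v \<Rightarrow> 'v) \<Rightarrow> bool" where
  "derivation_pair t D \<longleftrightarrow>
     Vector_Spaces.linear sG sG t \<and> Vector_Spaces.linear sV sV D \<and>
     (\<forall>x y. t (br x y) = br (t x) y + br x (t y)) \<and>
     (\<forall>x y z. t (tr x y z) = tr (t x) y z + tr x (t y) z + tr x y (t z)) \<and>
     (\<forall>x v. D (\<rho> x v) = \<rho> (t x) v + \<rho> x (D v)) \<and>
     (\<forall>x y v. D (\<mu> x y v) = \<mu> (t x) y v + \<mu> x (t y) v + \<mu> x y (D v))"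

text \<open>The two derivation rules are \<open>LY3\<close> and \<open>LY4\<close>. Solving the
  commutators in \<open>rep3\<close> and \<open>rep5\<close> for the term with \<open>D_op\<close>
  outermost gives the rules for \<rho> and \<mu>.\<close>

lemma derivation_pair_inner: "derivation_pair (tr x y) (D_op br \<rho> \<mu> x y)"
proof -
  have "D_op br \<rho> \<mu> x y (\<rho> z v) = \<rho> (tr x y z) v + \<rho> z (D_op br \<rho> \<mu> x y v)"
    and "D_op br \<rho> \<mu> x y (\<mu> z w v) =
      \<mu> (tr x y z) w v + \<mu> z (tr x y w) v + \<mu> z w (D_op br \<rho> \<mu> x y v)" for z w v
    by (simp_all only: rep3 rep5 diff_add_cancel)
  then show ?thesis
    unfolding derivation_pair_def using tr_linear D_op_linear LY3 LY4 by blast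
qed

lemma derivation_pair_zero: "derivation_pair (\<lambda>_. 0) (\<lambda>_. 0)"
proof -
  have "Vector_Spaces.linear sG sG (\<lambda>_. 0)" "Vector_Spaces.linear sV sV (\<lambda>_. 0)"
    by unfold_locales simp_all
  then show ?thesis
    by (simp add: derivation_pair_def)
qed

lemma derivation_pair_add:
  assumes "derivation_pair t D" "derivation_pair t' D'"
  shows "derivation_pair (\<lambda>x. t x + t' x) (\<lambda>v. D v + D' v)"
proof -
  have "Vector_Spaces.linear sG sG (\<lambda>x. t x + t' x)" "Vector_Spaces.linear sV sV (\<lambda>v. D v + D' v)"
    using assms vector_space_axioms V.vector_space_axioms
    by (auto simp: derivation_pair_def intro!: vector_space_pair.linear_compose_add vector_space_pair.intro)
  then show ?thesis
    using assms unfolding derivation_pair_def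
    by (simp add: br_left.add br_right.add tr_left.add tr_middle.add tr_right.add
        rho.add rho_arg.add mu.add mu_left.add mu_right.add algebra_simps)
qed

text \<open>Scalars are absorbed into the wedge factors, so X is a plain sum of wedges, and closure
  under zero and addition reduces the claim to inner pairs.\<close>

lemma derivation_pair_ext:
  assumes "X \<in> ext2 sG"
  shows "derivation_pair (tr_ext sG tr X) (D_ext br sV \<rho> \<mu> X)"
proof -
  obtain xs where X: "X = wedge_sum sG xs"
    using assms by (auto simp: ext2_eq_wedge_sums)
  have "derivation_pair (\<lambda>z. \<Sum>(x, y)\<leftarrow>xs. tr x y z) (\<lambda>v. \<Sum>(x, y)\<leftarrow>xs. D_op br \<rho> \<mu> x y v)"
    by (induction xs) (auto intro: derivation_pair_zero derivation_pair_add derivation_pair_inner)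
  then show ?thesis
    unfolding X D_ext_wedge_sum[symmetric] tr_ext_wedge_sum[symmetric] .
qed

text \<open>\<open>D_op\<close> is assembled from \<rho>, \<mu> and \<open>br\<close>, and the pair
  obeys a Leibniz rule for each of them.\<close>

lemma derivation_pair_D_op:
  assumes "derivation_pair t D"
  shows "D (D_op br \<rho> \<mu> x y v) =
    D_op br \<rho> \<mu> (t x) y v + D_op br \<rho> \<mu> x (t y) v + D_op br \<rho> \<mu> x y (D v)"
proof -
  interpret D: Vector_Spaces.linear sV sV D
    using assms by (simp add: derivation_pair_def)
  show ?thesis
    using assms unfolding derivation_pair_def D_op_def
    by (simp add: D.add D.diff rho.add rho_arg.add algebra_simps)
qed

end

context relative_rota_baxter
begin

sublocale T: Vector_Spaces.linear sV sG T
  by (rule T_linear)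

text \<open>The definition produces nested brackets and ternary brackets with x in the first slot;
  \<open>LY1\<close> collapses them into a single one with x in the last slot.\<close>

lemma D_op_sub:
  "D_op (sub_br \<rho> T) (sub_rho br \<rho> T) (sub_mu br tr \<rho> \<mu> T) u v x =
     tr (T u) (T v) x - T (\<mu> (T v) x u - \<mu> (T u) x v)"
proof -
  \<comment> \<open>This is \<open>LY1\<close> solved for one ternary bracket, with skew-symmetry
    moving x to the positions in which the expansion of \<open>D_op\<close> has it.\<close>
  have LY: "tr (T u) (T v) x = - br (br (T u) (T v)) x + br (T u) (br (T v) x)
      - br (T v) (br (T u) x) + tr x (T v) (T u) - tr x (T u) (T v)"
    using LY1[of "T u" "T v" x] br_skew[of "br (T v) x" "T u"] br_skew[of x "T u"]
      br_skew[of "br (T u) x" "T v"] tr_skew[of "T v" x "T u"]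
    by (simp add: br_left.neg algebra_simps eq_neg_iff_add_eq_0)
  have T_sub: "T (sub_br \<rho> T u v) = br (T u) (T v)"
    by (simp add: sub_br_def T_br)
  \<comment> \<open>\<open>T_br\<close> turns the mixed terms such as
    \<open>br (T u) (T (\<rho> x v))\<close> into values of T, where the \<rho>-terms
    cancel.\<close>
  show ?thesis
    unfolding LY
    unfolding D_op_def sub_rho_def T_sub sub_mu_def
    by (simp add: sub_br_def br_right.add rho_arg.add rho.diff T.add T.diff T_br
        br_skew[of x] rho_arg.neg algebra_simps)
qed

text \<open>After Leibniz expansion all terms containing t cancel in pairs. What remains are the
  Rota-Baxter identities with D applied to one argument at a time: \<open>T_br\<close> at
  \<open>(D u, v)\<close> and \<open>(u, D v)\<close>, and \<open>T_tr\<close> likewise for three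
  arguments.\<close>

lemma one_cocycle_derivation_pair:
  assumes "derivation_pair t D"
  shows "one_cocycle sV (sub_br \<rho> T) (sub_tr br \<rho> \<mu> T) sG (sub_rho br \<rho> T) (sub_mu br tr \<rho> \<mu> T)
    (\<lambda>v. T (D v) - t (T v))"
proof -
  interpret t: Vector_Spaces.linear sG sG t
    using assms by (simp add: derivation_pair_def)
  interpret D: Vector_Spaces.linear sV sV D
    using assms by (simp add: derivation_pair_def)
  interpret D_left: Vector_Spaces.linear sG sV "\<lambda>x. D_op br \<rho> \<mu> x y v" for y v
    using D_op_alternating by (simp add: alternating_map_def bilinear_map_def)
  have lin: "Vector_Spaces.linear sV sG (\<lambda>v. T (D v) - t (T v))"
    by unfold_locales
      (simp_all add: T.add D.add t.add T.scale D.scale t.scale scale_right_diff_distrib)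
  have dbr: "t (br x y) = br (t x) y + br x (t y)"
    and dtr: "t (tr x y z) = tr (t x) y z + tr x (t y) z + tr x y (t z)"
    and drho: "D (\<rho> x v) = \<rho> (t x) v + \<rho> x (D v)"
    and dmu: "D (\<mu> x y v) = \<mu> (t x) y v + \<mu> x (t y) v + \<mu> x y (D v)" for x y z v
    using assms by (auto simp: derivation_pair_def)
  \<comment> \<open>No rule moves t past T directly. But T carries the sub-adjacent brackets to
    those of g, and there t acts as a derivation.\<close>
  have t_T_br: "t (T (sub_br \<rho> T u v)) = br (t (T u)) (T v) + br (T u) (t (T v))" for u v
    using dbr[of "T u" "T v"] by (simp add: sub_br_def T_br)
  have t_T_tr: "t (T (sub_tr br \<rho> \<mu> T u v w)) =
      tr (t (T u)) (T v) (T w) + tr (T u) (t (T v)) (T w) + tr (T u) (T v) (t (T w))" for u v w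
    using dtr[of "T u" "T v" "T w"] by (simp add: sub_tr_def T_tr)
  have c1: "sub_rho br \<rho> T u (T (D v) - t (T v)) - sub_rho br \<rho> T v (T (D u) - t (T u))
      - (T (D (sub_br \<rho> T u v)) - t (T (sub_br \<rho> T u v))) = 0" for u v
    unfolding t_T_br unfolding sub_rho_def sub_br_def
    by (simp add: br_right.diff T_br rho_arg.diff drho T.add T.diff D.diff
        br_skew[of "T v" "t (T u)"] algebra_simps)
  have c2: "D_op (sub_br \<rho> T) (sub_rho br \<rho> T) (sub_mu br tr \<rho> \<mu> T) u v (T (D w) - t (T w))
      + sub_mu br tr \<rho> \<mu> T v w (T (D u) - t (T u)) - sub_mu br tr \<rho> \<mu> T u w (T (D v) - t (T v))
      - (T (D (sub_tr br \<rho> \<mu> T u v w)) - t (T (sub_tr br \<rho> \<mu> T u v w))) = 0" for u v w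
  proof -
    \<comment> \<open>\<open>sub_mu\<close> puts \<open>t (T v)\<close> into the first slot, while
      the Leibniz rules leave it in the second; skew-symmetry aligns the two so that they
      cancel.\<close>
    have skew: "tr (T u) (t (T v)) (T w) = - tr (t (T v)) (T u) (T w)"
      "tr (T u) (T (D v)) (T w) = - tr (T (D v)) (T u) (T w)"
      "D_op br \<rho> \<mu> (T u) (t (T v)) w = - D_op br \<rho> \<mu> (t (T v)) (T u) w"
      by (rule tr_skew alternating_map_skew[OF D_op_alternating])+
    show ?thesis
      unfolding t_T_tr D_op_sub
      unfolding sub_mu_def sub_tr_def
      by (simp add: skew tr_left.diff tr_right.diff D_left.diff mu_left.diff mu_right.diff
          T.add T.diff T.neg D.add D.diff dmu derivation_pair_D_op[OF assms] T_tr algebra_simps)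
  qed
  show ?thesis
    unfolding one_cocycle_def using lin c1 c2 by blast
qed

lemma one_cocycle_rb_delta:
  assumes "X \<in> ext2 sG"
  shows "one_cocycle sV (sub_br \<rho> T) (sub_tr br \<rho> \<mu> T) sG (sub_rho br \<rho> T) (sub_mu br tr \<rho> \<mu> T)
    (rb_delta sG br tr sV \<rho> \<mu> T X)"
  using one_cocycle_derivation_pair[OF derivation_pair_ext[OF assms]]
  by (simp add: rb_delta_def[abs_def])

end

theorem proposition4p14:
  fixes sG :: "'k::field_char_0 \<Rightarrow> 'g::ab_group_add \<Rightarrow> 'g"
    and sV :: "'k \<Rightarrow> 'v::ab_group_add \<Rightarrow> 'v"
    and br :: "'g \<Rightarrow> 'g \<Rightarrow> 'g"
    and tr :: "'g \<Rightarrow> 'g \<Rightarrow> 'g \<Rightarrow> 'g"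
    and \<rho> :: "'g \<Rightarrow> 'v \<Rightarrow> 'v"
    and \<mu> :: "'g \<Rightarrow> 'g \<Rightarrow> 'v \<Rightarrow> 'v"
    and T :: "'v \<Rightarrow> 'g"
  assumes "relative_rota_baxter sG br tr sV \<rho> \<mu> T"
  shows "\<forall>X \<in> ext2 sG.
           one_cocycle sV (sub_br \<rho> T) (sub_tr br \<rho> \<mu> T)
             sG (sub_rho br \<rho> T) (sub_mu br tr \<rho> \<mu> T)
             (rb_delta sG br tr sV \<rho> \<mu> T X)"
  using relative_rota_baxter.one_cocycle_rb_delta[OF assms] by blast

end
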